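(* Let $n \geq 1$, let $K$ be any field and let $T\colon M_n(K) \to M_n(K)$ be a linear map. Then $T$ preserves $\mathcal{H}$ if and only if either $T = 0$ or $T$ preserves invertibility.
   Context: $M_n(K)$ is the set of $n \times n$ matrices over $K$, viewed as a $K$-vector space and as a monoid under multiplication. Green's relations on $M_n(K)$: $A\,\mathcal{L}\,B$ if there exist $X, Y \in M_n(K)$ with $A = XB$ and $B = YA$; $A\,\mathcal{R}\,B$ if there exist $X, Y \in M_n(K)$ with $A = BX$ and $B = AY$; $A\,\mathcal{H}\,B$ if $A\,\mathcal{L}\,B$ and $A\,\mathcal{R}\,B$. $T$ preserves $\mathcal{H}$ if $A\,\mathcal{H}\,B$ implies $T(A)\,\mathcal{H}\,T(B)$ for all $A,B \in M_n(K)$. $T$ preserves invertibility if $T(A)$ is invertible whenever $A \in M_n(K)$ is invertible. *)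

theory Defs
  imports "HOL-Analysis.Analysis"
begin

text \<open>
  The monoid \<open>M\<^sub>n(K)\<close> is the type \<^typ>\<open>'a::field ^'n ^'n\<close> with the product \<open>**\<close>, where \<open>n\<close> is
  the cardinality of the finite index type \<open>'n\<close>; as types are inhabited, \<open>n \<ge> 1\<close>.
\<close>

definition green_L :: "'a::field ^'n ^'n \<Rightarrow> 'a ^'n ^'n \<Rightarrow> bool" where
  "green_L A B \<longleftrightarrow> (\<exists>X Y. A = X ** B \<and> B = Y ** A)"

definition green_R :: "'a::field ^'n ^'n \<Rightarrow> 'a ^'n ^'n \<Rightarrow> bool" where
  "green_R A B \<longleftrightarrow> (\<exists>X Y. A = B ** X \<and> B = A ** Y)"

definition green_H :: "'a::field ^'n ^'n \<Rightarrow> 'a ^'n ^'n \<Rightarrow> bool" where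
  "green_H A B \<longleftrightarrow> green_L A B \<and> green_R A B"

definition preserves_H :: "('a::field ^'n ^'n \<Rightarrow> 'a ^'n ^'n) \<Rightarrow> bool" where
  "preserves_H T \<longleftrightarrow> (\<forall>A B. green_H A B \<longrightarrow> green_H (T A) (T B))"

definition preserves_invertibility :: "('a::field ^'n ^'n \<Rightarrow> 'a ^'n ^'n) \<Rightarrow> bool" where
  "preserves_invertibility T \<longleftrightarrow> (\<forall>A. invertible A \<longrightarrow> invertible (T A))"

text \<open>
  The library's \<open>*s\<close> scales a vector by an element of its entry type, and the entries of a matrix
  are its rows; so the \<open>K\<close>-vector space structure on matrices is given here.
\<close>

definition matrix_scale :: "'a::field \<Rightarrow> 'a ^'n ^'n \<Rightarrow> 'a ^'n ^'n" where
  "matrix_scale c A = map_matrix ((*) c) A"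

interpretation matrix: vector_space matrix_scale
  by unfold_locales (simp_all add: matrix_scale_def vec_eq_iff algebra_simps)

end

theory Submission
  imports Defs
begin

text \<open>
  Let \<open>f\<close> be a linear map from \<open>M\<^sub>n(K)\<close> to \<open>K\<^sup>n\<close> that vanishes at no invertible matrix. Then \<open>f\<close> is
  surjective, and its kernel is \<open>{A. A x = 0}\<close> or \<open>{A. A\<^sup>T w = 0}\<close> for some vector (a form of
  Dieudonne's theorem on spaces of singular matrices). If \<open>T\<close> preserves invertibility, this applies
  to \<open>A \<mapsto> T(A) v\<close> and \<open>A \<mapsto> T(A)\<^sup>T v\<close> for every \<open>v \<noteq> 0\<close>; as \<open>\<H>\<close>-related matrices have the same
  kernel and the same left kernel, so do their images. Conversely, if \<open>T\<close> preserves \<open>\<H>\<close> and is not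
  zero, then for invertible \<open>A\<close> some \<open>B \<mapsto> T(B) v\<close> vanishes at no invertible matrix, so it is
  surjective, while its values lie in the range of \<open>T(A)\<close>, because the invertible matrices span.

  To find the kernel of \<open>f\<close>, write \<open>S\<^sub>F\<close> for the matrices that vanish on a subspace \<open>F\<close>. If \<open>f\<close> maps
  \<open>S\<^sub>F\<close> onto the whole space for some line \<open>F\<close>, then either a flag can be built step by step along
  which an invertible matrix in the kernel is found, or all maps \<open>p \<mapsto> f (x p\<^sup>T)\<close> on the annihilator
  of \<open>F\<close> have rank at most one, which forces \<open>f A = R (A x)\<close>. If this happens for no line, then for
  each line a nonzero functional kills \<open>f S\<^sub>F\<close>, which forces \<open>f A = R (A\<^sup>T w)\<close>.
\<close>

section \<open>The scalar product, rank one matrices and annihilators\<close>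

abbreviation dot :: "'a::field ^'n \<Rightarrow> 'a ^'n \<Rightarrow> 'a" where
  "dot \<equiv> scalar_product"

definition outer :: "'a::field ^'n \<Rightarrow> 'a ^'n \<Rightarrow> 'a ^'n ^'n" where
  "outer x p = (\<chi> i j. x $ i * p $ j)"

definition annih :: "('a::field ^'n) set \<Rightarrow> ('a ^'n) set" where
  "annih F = {p. \<forall>v\<in>F. dot p v = 0}"

lemma dot_simps [simp]:
  "dot (p + q) v = dot p v + dot q v" "dot (p - q) v = dot p v - dot q v" "dot (c *s p) v = c * dot p v"
  "dot p (v + w) = dot p v + dot p w" "dot p (v - w) = dot p v - dot p w" "dot p (c *s v) = c * dot p v"
  "dot 0 v = 0" "dot p 0 = 0"
  by (simp_all add: scalar_product_def sum.distrib sum_subtractf sum_distrib_left algebra_simps)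

lemma dot_axis [simp]: "dot (axis i 1) v = v $ i" "dot v (axis i 1) = v $ i"
  by (simp_all add: scalar_product_def axis_def if_distrib[of "\<lambda>c. c * _"] if_distrib[of "\<lambda>c. _ * c"]
      cong: if_cong)

lemma outer_mult_vec [simp]: "outer x p *v v = dot p v *s x"
  by (simp add: outer_def scalar_product_def matrix_vector_mult_def vec_eq_iff sum_distrib_left mult_ac)

lemma mult_outer: "A ** outer x p = outer (A *v x) p"
  by (simp add: outer_def matrix_matrix_mult_def matrix_vector_mult_def vec_eq_iff sum_distrib_left mult_ac)

lemma outer_simps:
  "outer (x + y) p = outer x p + outer y p" "outer x (p + q) = outer x p + outer x q"
  "outer x (p - q) = outer x p - outer x q"
  "outer (c *s x) p = matrix_scale c (outer x p)" "outer x (c *s p) = matrix_scale c (outer x p)"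
  "transpose (outer x p) = outer p x"
  by (simp_all add: outer_def matrix_scale_def map_matrix_def vec_eq_iff transpose_def algebra_simps)

lemma matrix_eq_sum_outer: "A = (\<Sum>j\<in>UNIV. outer (column j A) (axis j 1))"
  by (simp add: outer_def column_def vec_eq_iff axis_def if_distrib[of "\<lambda>c. _ * c"] cong: if_cong)

text \<open>Columns split a matrix into summands \<open>outer x p\<close>, so a linear statement
  need only be checked on those.\<close>

lemma subspace_outer_UNIV:
  assumes "matrix.subspace V" "\<And>x p. outer x p \<in> V"
  shows "A \<in> V"
  by (subst matrix_eq_sum_outer) (intro matrix.subspace_sum assms)

lemma annih_mono: "F \<subseteq> G \<Longrightarrow> annih G \<subseteq> annih F"
  by (auto simp: annih_def)

lemma annih_span_insert:
  assumes "vec.subspace F"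
  shows "p \<in> annih (vec.span (insert y F)) \<longleftrightarrow> p \<in> annih F \<and> dot p y = 0"
  (is "?L \<longleftrightarrow> ?R")
proof
  show "?L \<Longrightarrow> ?R"
    by (auto simp: annih_def intro: vec.span_base)
next
  assume R: ?R
  have "dot p v = 0" if "v \<in> vec.span (insert y F)" for v
  proof -
    from that obtain k where "v - k *s y \<in> F"
      using assms by (auto simp: vec.span_insert vec.span_eq_iff[THEN iffD2])
    then have "dot p (v - k *s y) = 0"
      using R by (auto simp: annih_def)
    then show ?thesis
      using R by simp
  qed
  then show ?L
    by (simp add: annih_def)
qed

lemma invertible_iff_ker:
  fixes A :: "'a::field ^'n ^'n"
  shows "invertible A \<longleftrightarrow> (\<forall>v. A *v v = 0 \<longrightarrow> v = 0)"
  by (simp add: invertible_left_inverse matrix_left_invertible_ker)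

text \<open>A basis of \<open>F\<close> together with \<open>y\<close> is independent, so some
  linear \<open>g\<close> kills \<open>F\<close> and fixes \<open>y\<close>. A coordinate of
  \<open>g\<close> in which \<open>y\<close> is nonzero, rescaled, is the functional.\<close>

lemma separating_functional:
  fixes F :: "('a::field ^'n) set"
  assumes "vec.subspace F" "y \<notin> F"
  obtains p where "p \<in> annih F" "dot p y = 1"
proof -
  obtain B where B: "B \<subseteq> F" "vec.independent B" "vec.span B = F"
    using vec.basis_subspace_exists[OF assms(1)] by metis
  then have "vec.independent (insert y B)"
    using assms by (simp add: vec.independent_insert)
  from vec.linear_independent_extend[OF this, of "\<lambda>v. if v = y then y else 0"]
  obtain g where g: "Vector_Spaces.linear (*s) (*s) g" "g y = y" "\<And>b. b \<in> B \<Longrightarrow> g b = 0"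
    using B assms by force
  then have g0: "g v = 0" if "v \<in> F" for v
    using vec.linear_eq_0_on_span[OF g(1), of B v] B that by auto
  have "y \<noteq> 0"
    using assms vec.subspace_0 by metis
  then obtain i where i: "y $ i \<noteq> 0"
    by (auto simp: vec_eq_iff)
  define p where "p = (1 / y $ i) *s row i (matrix g)"
  have p: "dot p v = g v $ i / y $ i" for v
    using matrix_works[OF g(1), of v]
    by (simp add: p_def scalar_product_def row_def matrix_vector_mult_def vec_eq_iff flip: sum_divide_distrib)
  show thesis
    by (rule that[of p]) (auto simp: p g g0 i annih_def)
qed

lemma dot_eq_0_all: "(\<And>v. dot p v = 0) \<Longrightarrow> p = 0"
  by (metis dot_axis(2) vec_eq_iff zero_index)

text \<open>\<open>C\<close> is the identity plus \<open>outer (x - y) s\<close>, where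
  \<open>s\<close> kills \<open>F\<close>, is 1 at \<open>y\<close> and nonzero at \<open>x\<close>.
  Then \<open>dot s (C *v v) = dot s v * dot s x\<close>, so \<open>C *v v = 0\<close> forces
  \<open>dot s v = 0\<close> and hence \<open>v = 0\<close>.\<close>

lemma invertible_fixing_maps_to:
  fixes F :: "('a::field ^'n) set"
  assumes "vec.subspace F" "x \<notin> F" "y \<notin> F"
  obtains C where "invertible C" "\<And>v. v \<in> F \<Longrightarrow> C *v v = v" "C *v y = x"
proof -
  obtain p where p: "p \<in> annih F" "dot p x = 1"
    using separating_functional[OF assms(1,2)] .
  obtain q where q: "q \<in> annih F" "dot q y = 1"
    using separating_functional[OF assms(1,3)] .
  \<comment> \<open>Over any field, one of \<open>p\<close>, \<open>q\<close> and
    \<open>p + q\<close> is nonzero at both vectors.\<close>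
  obtain r where r: "r \<in> annih F" "dot r x \<noteq> 0" "dot r y \<noteq> 0"
  proof -
    consider "dot p y \<noteq> 0" | "dot q x \<noteq> 0" | "dot p y = 0" "dot q x = 0"
      by blast
    then show thesis
    proof cases
      case 3
      have "p + q \<in> annih F"
        using p(1) q(1) by (simp add: annih_def)
      moreover have "dot (p + q) x \<noteq> 0" "dot (p + q) y \<noteq> 0"
        using p(2) q(2) 3 by simp_all
      ultimately show thesis
        by (rule that)
    qed (use p q that in simp_all)
  qed
  define s where "s = (1 / dot r y) *s r"
  have s: "s \<in> annih F" "dot s x \<noteq> 0" "dot s y = 1"
    using r by (simp_all add: s_def annih_def)
  define C where "C = mat 1 + outer (x - y) s"
  have C: "C *v v = v + dot s v *s (x - y)" for v
    by (simp add: C_def matrix_vector_mult_add_rdistrib)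
  have ker: "v = 0" if "C *v v = 0" for v
  proof -
    have "dot s (v + dot s v *s (x - y)) = 0"
      using that C[of v] by simp
    then have "dot s v * dot s x = 0"
      unfolding dot_simps s(3) by (simp add: right_diff_distrib)
    then have "dot s v = 0"
      using s(2) by simp
    then show ?thesis
      using that C[of v] by simp
  qed
  show thesis
  proof (rule that)
    show "invertible C"
      unfolding invertible_iff_ker using ker by blast
    show "C *v v = v" if "v \<in> F" for v
    proof -
      have "dot s v = 0"
        using s(1) that by (simp add: annih_def)
      then show ?thesis
        by (simp add: C)
    qed
    show "C *v y = x"
      by (simp add: C s(3))
  qed
qed

section \<open>Images of the matrices that vanish on a subspace\<close>

text \<open>The matrices \<open>outer x p\<close> with \<open>p\<close> in \<open>annih F\<close>
  span the space of matrices that vanish on \<open>F\<close>. So this is the span of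
  \<open>N\<close> plus the image of that space under \<open>f\<close>.\<close>

definition reach :: "('a::field ^'n ^'n \<Rightarrow> 'a ^'n) \<Rightarrow> ('a ^'n) set \<Rightarrow> ('a ^'n) set \<Rightarrow> ('a ^'n) set" where
  "reach f N F = vec.span (N \<union> {f (outer x p) | x p. p \<in> annih F})"

lemma reach_subspace: "vec.subspace (reach f N F)"
  by (simp add: reach_def)

lemma reach_base: "v \<in> N \<Longrightarrow> v \<in> reach f N F"
  and reach_outer: "p \<in> annih F \<Longrightarrow> f (outer x p) \<in> reach f N F"
  by (auto simp: reach_def intro: vec.span_base)

lemma reach_least:
  assumes "vec.subspace V" "N \<subseteq> V" "\<And>x p. p \<in> annih F \<Longrightarrow> f (outer x p) \<in> V"
  shows "reach f N F \<subseteq> V"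
  unfolding reach_def using assms by (intro vec.span_minimal) auto

lemma reach_antimono: "F \<subseteq> G \<Longrightarrow> reach f N G \<subseteq> reach f N F"
  using annih_mono[of F G] by (intro reach_least reach_subspace) (auto intro: reach_base reach_outer)

lemma annih_diff: "p \<in> annih F \<Longrightarrow> q \<in> annih F \<Longrightarrow> p - c *s q \<in> annih F"
  by (simp add: annih_def)

text \<open>Each vector of \<open>B\<close> that enlarges the span strictly shrinks
  \<open>reach\<close>, so every gain in the second summand is paid for by a loss in the
  first.\<close>

lemma dim_reach_le:
  fixes f :: "'a::field ^'n ^'n \<Rightarrow> 'a ^'n"
  assumes lin: "Vector_Spaces.linear matrix_scale (*s) f" and F: "vec.subspace F"
    and full: "reach f N F = UNIV"
    and proper: "\<And>y. y \<notin> F \<Longrightarrow> reach f N (vec.span (insert y F)) \<noteq> UNIV"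
    and "finite B"
  shows "vec.dim (reach f N (vec.span (F \<union> B))) + vec.dim (F \<union> B) \<le> CARD('n) + vec.dim F"
  using \<open>finite B\<close>
proof (induction B)
  case empty
  then show ?case
    using dim_subset_UNIV_cart_gen by auto
next
  case (insert y B)
  interpret f: Vector_Spaces.linear matrix_scale "(*s)" f by (rule lin)
  define G where "G = vec.span (F \<union> B)"
  have sG: "vec.subspace G" and FG: "F \<subseteq> G"
    by (auto simp: G_def intro: vec.span_base)
  have eq: "vec.span (F \<union> insert y B) = vec.span (insert y G)"
    by (simp add: G_def vec.span_insert vec.span_span)
  show ?case
  proof (cases "y \<in> G")
    case True
    then have "vec.span (F \<union> insert y B) = vec.span (F \<union> B)"
      by (simp add: G_def vec.span_redundant)
    moreover from this have "vec.dim (F \<union> insert y B) = vec.dim (F \<union> B)"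
      by (rule vec.span_eq_dim)
    ultimately show ?thesis
      using insert.IH by simp
  next
    case False
    have "reach f N (vec.span (insert y G)) \<noteq> reach f N G"
    proof
      assume *: "reach f N (vec.span (insert y G)) = reach f N G"
      obtain q where q: "q \<in> annih G" "dot q y = 1"
        using separating_functional[OF sG False] .
      define R where "R = reach f N (vec.span (insert y F))"
      have "f (outer x q) \<in> R" for x
        using reach_antimono[of "vec.span (insert y F)" "vec.span (insert y G)" f N]
          vec.span_mono[OF insert_mono[OF FG, of y]] reach_outer[OF q(1), of f x N] *
        by (auto simp: R_def)
      \<comment> \<open>Any \<open>p\<close> in \<open>annih F\<close> is the sum of this
        functional, which also kills \<open>y\<close>, and a multiple of \<open>q\<close>. Hence if
        adjoining \<open>y\<close> to \<open>G\<close> lost nothing, adjoining it to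
        \<open>F\<close> would lose nothing either, against \<open>proper\<close>.\<close>
      moreover have "f (outer x (p - dot p y *s q)) \<in> R" if "p \<in> annih F" for x p
        unfolding R_def using that q annih_mono[OF FG]
        by (intro reach_outer) (auto simp: annih_span_insert[OF F] annih_diff)
      ultimately have "f (outer x p) \<in> R" if "p \<in> annih F" for x p
        using that vec.subspace_add[OF reach_subspace] vec.subspace_scale[OF reach_subspace]
        by (metis R_def diff_add_cancel f.add f.scale outer_simps(2,5))
      then have "reach f N F \<subseteq> R"
        unfolding R_def by (intro reach_least reach_subspace) (auto intro: reach_base)
      moreover have "y \<notin> F"
        using False FG by auto
      ultimately show False
        using full proper by (auto simp: R_def)
    qed
    moreover have "G \<subseteq> vec.span (insert y G)"
      by (auto intro: vec.span_base)
    ultimately have "reach f N (vec.span (insert y G)) \<subset> reach f N G"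
      using reach_antimono by blast
    then have "vec.dim (reach f N (vec.span (insert y G))) < vec.dim (reach f N G)"
      by (intro vec.dim_psubset) (metis reach_subspace vec.span_eq_iff)
    moreover have "vec.dim (F \<union> insert y B) = vec.dim (F \<union> B) + 1"
      using False by (simp add: vec.dim_insert G_def)
    ultimately show ?thesis
      using insert.IH eq by (simp add: G_def)
  qed
qed

text \<open>Otherwise \<open>dim_reach_le\<close> with the standard basis for \<open>B\<close> gives
  dim N + n \<le> n + dim F, because \<open>reach\<close> always contains \<open>N\<close>.\<close>

lemma reach_extend:
  fixes f :: "'a::field ^'n ^'n \<Rightarrow> 'a ^'n"
  assumes lin: "Vector_Spaces.linear matrix_scale (*s) f" and F: "vec.subspace F"
    and full: "reach f N F = UNIV" and dim: "vec.dim F < vec.dim N"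
  obtains y where "y \<notin> F" "reach f N (vec.span (insert y F)) = UNIV"
proof (rule ccontr)
  assume "\<not> thesis"
  then have "vec.dim (reach f N (vec.span (F \<union> cart_basis))) + vec.dim (F \<union> cart_basis) \<le> CARD('n) + vec.dim F"
    using that by (intro dim_reach_le assms finite_cart_basis) blast
  moreover have "vec.span (F \<union> cart_basis) = UNIV"
    using vec.span_mono[of cart_basis "F \<union> cart_basis"] by auto
  moreover from this have "vec.dim (F \<union> cart_basis) = CARD('n)"
    by (metis vec.dim_span vec_dim_card)
  moreover have "vec.dim N \<le> vec.dim (reach f N UNIV)"
    by (intro vec.dim_subset subsetI reach_base)
  ultimately show False
    using dim by simp
qed

section \<open>Invertible matrices sent into a given subspace\<close>

lemma linear_comp_mult:
  assumes "Vector_Spaces.linear matrix_scale s f"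
  shows "Vector_Spaces.linear matrix_scale s (\<lambda>A. f (C ** A))"
proof -
  interpret f: Vector_Spaces.linear matrix_scale s f by (rule assms)
  have "C ** matrix_scale c A = matrix_scale c (C ** A)" for c A
    by (simp add: matrix_scale_def map_matrix_def matrix_matrix_mult_def vec_eq_iff sum_distrib_left mult_ac)
  then show ?thesis
    by unfold_locales (simp_all add: matrix_add_ldistrib f.add f.scale)
qed

lemma invertible_mult_vec_surj:
  fixes C :: "'a::field ^'n ^'n"
  assumes "invertible C"
  obtains w where "C *v w = v"
  using assms by (metis invertible_def matrix_vector_mul_assoc matrix_vector_mul_lid)

text \<open>The matrix is \<open>C\<close> times I - y p^T, which has the inverse I + y p^T because
  \<open>p\<close> kills \<open>y\<close>.\<close>

lemma invertible_minus_outer: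
  fixes C :: "'a::field ^'n ^'n"
  assumes "invertible C" "dot p y = 0"
  shows "invertible (C - outer (C *v y) p)"
proof -
  have "v = 0" if v: "(C - outer (C *v y) p) *v v = 0" for v
  proof -
    have "C *v (v - dot p v *s y) = 0"
      using v by (simp add: matrix_vector_mult_diff_rdistrib vec.diff vec.scale)
    then have "v - dot p v *s y = 0"
      using assms by (simp only: invertible_iff_ker)
    then have "v = dot p v *s y"
      by simp
    moreover from this have "dot p v = dot p v * dot p y"
      by (metis dot_simps(6))
    ultimately show ?thesis
      using assms by simp
  qed
  then show ?thesis
    by (simp add: invertible_iff_ker)
qed

text \<open>\<open>C\<close> permutes the vectors \<open>x\<close>, so for fixed \<open>p\<close>
  the matrices \<open>C ** outer x p\<close> are again all the \<open>outer x p\<close>.\<close>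

lemma reach_comp_mult:
  assumes "invertible C" "reach f N F = UNIV" "N \<subseteq> N'"
  shows "reach (\<lambda>A. f (C ** A)) N' F = UNIV"
proof -
  have "reach f N F \<subseteq> reach (\<lambda>A. f (C ** A)) N' F"
  proof (intro reach_least reach_subspace)
    show "f (outer x p) \<in> reach (\<lambda>A. f (C ** A)) N' F" if "p \<in> annih F" for x p
    proof -
      obtain w where "C *v w = x"
        using invertible_mult_vec_surj assms(1) by blast
      then show ?thesis
        using reach_outer[OF that, of "\<lambda>A. f (C ** A)" w N'] by (simp add: mult_outer)
    qed
  qed (use assms in \<open>auto intro: reach_base\<close>)
  then show ?thesis
    using assms by auto
qed

lemma linear_outer:
  assumes lin: "Vector_Spaces.linear matrix_scale (*s) f"
  shows "f (outer (x + y) p) = f (outer x p) + f (outer y p)"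
    "f (outer x (p + q)) = f (outer x p) + f (outer x q)"
    "f (outer x (p - q)) = f (outer x p) - f (outer x q)"
    "f (outer (c *s x) p) = c *s f (outer x p)" "f (outer x (c *s p)) = c *s f (outer x p)"
    "f (outer 0 p) = 0" "f (outer x 0) = 0"
proof -
  interpret f: Vector_Spaces.linear matrix_scale "(*s)" f by (rule lin)
  show *: "f (outer (x + y) p) = f (outer x p) + f (outer y p)"
    "f (outer x (p + q)) = f (outer x p) + f (outer x q)"
    "f (outer x (p - q)) = f (outer x p) - f (outer x q)"
    "f (outer (c *s x) p) = c *s f (outer x p)" "f (outer x (c *s p)) = c *s f (outer x p)" for c x y p q
    by (simp_all only: outer_simps f.add f.scale f.diff)
  show "f (outer 0 p) = 0" "f (outer x 0) = 0"
    using *(4)[of 0 0 p] *(5)[of x 0 0] by simp_all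
qed

lemma subspace_outer_annih:
  fixes f :: "'a::field ^'n ^'n \<Rightarrow> 'a ^'n"
  assumes "Vector_Spaces.linear matrix_scale (*s) f"
  shows "vec.subspace {f (outer x p) | p. p \<in> annih F}"
proof (rule vec.subspaceI)
  note lo = linear_outer[OF assms]
  have "0 \<in> annih F"
    by (simp add: annih_def)
  then show "0 \<in> {f (outer x p) | p. p \<in> annih F}"
    using lo(7)[of x] by (metis (mono_tags, lifting) mem_Collect_eq)
next
  note lo = linear_outer[OF assms]
  fix v w assume "v \<in> {f (outer x p) | p. p \<in> annih F}" "w \<in> {f (outer x p) | p. p \<in> annih F}"
  then obtain p q where "p \<in> annih F" "q \<in> annih F" "v + w = f (outer x (p + q))"
    by (auto simp: lo)
  moreover from this have "p + q \<in> annih F"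
    by (simp add: annih_def)
  ultimately show "v + w \<in> {f (outer x p) | p. p \<in> annih F}"
    by blast
next
  note lo = linear_outer[OF assms]
  fix c v assume "v \<in> {f (outer x p) | p. p \<in> annih F}"
  then obtain p where "p \<in> annih F" "c *s v = f (outer x (c *s p))"
    by (auto simp: lo)
  moreover from this have "c *s p \<in> annih F"
    by (simp add: annih_def)
  ultimately show "c *s v \<in> {f (outer x p) | p. p \<in> annih F}"
    by blast
qed

text \<open>
  The step of a downward induction along a flag: a solution \<open>C\<close> for the larger pair \<open>F'\<close>, \<open>N'\<close> is
  corrected by the rank one matrix \<open>outer (C y) q\<close>. This keeps it invertible, since \<open>q\<close> kills \<open>y\<close>.
\<close>

lemma exists_invertible_mapped_into_step:
  fixes f :: "'a::field ^'n ^'n \<Rightarrow> 'a ^'n"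
  assumes lin: "Vector_Spaces.linear matrix_scale (*s) f"
    and F: "vec.subspace F" and N: "vec.subspace N"
    and FN: "\<And>x p. x \<in> F \<Longrightarrow> p \<in> annih F \<Longrightarrow> f (outer x p) \<in> N"
    and x: "x \<notin> F" and y: "y \<notin> F" and full: "reach f N (vec.span (insert y F)) = UNIV"
  defines "F' \<equiv> vec.span (insert y F)"
  defines "N' \<equiv> {a + b | a b. a \<in> N \<and> b \<in> {f (outer x p) | p. p \<in> annih F'}}"
  assumes step: "\<And>g. Vector_Spaces.linear matrix_scale (*s) g \<Longrightarrow>
      (\<And>z q. z \<in> F' \<Longrightarrow> q \<in> annih F' \<Longrightarrow> g (outer z q) \<in> N') \<Longrightarrow> reach g N' F' = UNIV \<Longrightarrow>
      \<exists>C. invertible C \<and> (\<forall>v\<in>F'. C *v v = v) \<and> g C \<in> N'"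
  shows "\<exists>C. invertible C \<and> (\<forall>v\<in>F. C *v v = v) \<and> f C \<in> N"
proof -
  interpret f: Vector_Spaces.linear matrix_scale "(*s)" f by (rule lin)
  have FF': "F \<subseteq> F'" "y \<in> F'"
    by (auto simp: F'_def intro: vec.span_base)
  obtain C1 where C1: "invertible C1" "\<And>v. v \<in> F \<Longrightarrow> C1 *v v = v" "C1 *v y = x"
    using invertible_fixing_maps_to F x y by metis
  \<comment> \<open>As \<open>C1\<close> fixes \<open>F\<close> and moves \<open>y\<close> to
    \<open>x\<close>, the map \<open>g\<close> sends \<open>outer y q\<close> to
    \<open>f (outer x q)\<close>, which lies in \<open>N'\<close> for \<open>q\<close> in
    \<open>annih F'\<close>. So \<open>g\<close> meets for \<open>F'\<close> and \<open>N'\<close>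
    the condition that \<open>f\<close> meets for \<open>F\<close> and \<open>N\<close>.\<close>
  define g where "g = (\<lambda>A. f (C1 ** A))"
  have sN': "vec.subspace N'"
    unfolding N'_def by (intro vec.subspace_sums N subspace_outer_annih lin)
  have "0 \<in> {f (outer x p) | p. p \<in> annih F'}"
    by (intro vec.subspace_0 subspace_outer_annih lin)
  then have NN': "N \<subseteq> N'"
    unfolding N'_def by force
  have xN': "f (outer x q) \<in> N'" if "q \<in> annih F'" for q
    unfolding N'_def using that vec.subspace_0[OF N] by force
  have g: "g (outer z q) \<in> N'" if z: "z \<in> F'" and q: "q \<in> annih F'" for z q
  proof -
    have "vec.span F = F"
      using F by simp
    then obtain k where k: "z - k *s y \<in> F"
      using z unfolding F'_def vec.span_insert by (simp only: mem_Collect_eq) blast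
    then have "C1 *v (z - k *s y) = z - k *s y"
      by (rule C1)
    then have "C1 *v z = (z - k *s y) + k *s x"
      using C1(3) by (simp add: vec.diff vec.scale algebra_simps)
    then have "g (outer z q) = f (outer (z - k *s y) q) + k *s f (outer x q)"
      by (simp only: g_def mult_outer outer_simps f.add f.scale)
    moreover have "f (outer (z - k *s y) q) \<in> N'"
      using k q annih_mono[OF FF'(1)] FN NN' by auto
    ultimately show ?thesis
      using xN'[OF q] sN' by (simp add: vec.subspace_add vec.subspace_scale)
  qed
  obtain C where C: "invertible C" "\<And>v. v \<in> F' \<Longrightarrow> C *v v = v" "g C \<in> N'"
    using step[of g] g reach_comp_mult[OF C1(1) full NN'] linear_comp_mult[OF lin]
    by (auto simp: g_def F'_def)
  then obtain a q where a: "a \<in> N" "q \<in> annih F'" "f (C1 ** C) = a + f (outer x q)"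
    by (auto simp: N'_def g_def)
  define D where "D = C1 ** C - outer x q"
  have "f D = a"
    using a by (simp add: D_def f.diff)
  moreover have "invertible D"
  proof -
    have "invertible (C1 ** C)"
      using C1 C by (simp add: invertible_mult)
    moreover have "dot q y = 0"
      using a FF' by (auto simp: annih_def)
    moreover have "(C1 ** C) *v y = x"
      using C C1 FF' by (simp flip: matrix_vector_mul_assoc)
    ultimately show ?thesis
      unfolding D_def by (metis invertible_minus_outer)
  qed
  moreover have "D *v v = v" if "v \<in> F" for v
  proof -
    have "dot q v = 0" "v \<in> F'"
      using a FF' that by (auto simp: annih_def)
    then show ?thesis
      using C C1 that by (simp add: D_def matrix_vector_mult_diff_rdistrib flip: matrix_vector_mul_assoc)
  qed
  ultimately show ?thesis
    using a by auto
qed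

text \<open>Induction on the codimension of \<open>N\<close>. \<open>reach_extend\<close> supplies a
  vector to adjoin to \<open>F\<close>, and \<open>N\<close> grows by the values
  \<open>f (outer x p)\<close> for a suitable \<open>x\<close>. The dimension of \<open>F\<close>
  rises by exactly one and that of \<open>N\<close> by at least one, so their strict inequality
  survives until \<open>N\<close> is everything, where the identity matrix serves.\<close>

lemma exists_invertible_mapped_into:
  fixes f :: "'a::field ^'n ^'n \<Rightarrow> 'a ^'n"
  assumes "Vector_Spaces.linear matrix_scale (*s) f" "vec.subspace F" "vec.subspace N"
    and "\<And>x p. x \<in> F \<Longrightarrow> p \<in> annih F \<Longrightarrow> f (outer x p) \<in> N"
    and "vec.dim F < vec.dim N" and "reach f N F = UNIV"
  shows "\<exists>C. invertible C \<and> (\<forall>v\<in>F. C *v v = v) \<and> f C \<in> N"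
  using assms
proof (induction "CARD('n) - vec.dim N" arbitrary: f F N rule: less_induct)
  case less
  show ?case
  proof (cases "N = UNIV")
    case True
    then show ?thesis
      by (intro exI[of _ "mat 1"]) (auto simp: invertible_def)
  next
    case False
    obtain y where y: "y \<notin> F" "reach f N (vec.span (insert y F)) = UNIV"
      using reach_extend less.prems by metis
    define F' where "F' = vec.span (insert y F)"
    have FF': "F \<subseteq> F'"
      by (auto simp: F'_def intro: vec.span_base)
    have "\<exists>x p. p \<in> annih F' \<and> f (outer x p) \<notin> N"
    proof (rule ccontr)
      assume "\<not> ?thesis"
      then have "reach f N F' \<subseteq> N"
        using less.prems by (intro reach_least) auto
      then show False
        using y False by (auto simp: F'_def)
    qed
    then obtain x p where xp: "p \<in> annih F'" "f (outer x p) \<notin> N"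
      by blast
    \<comment> \<open>\<open>p\<close> also kills \<open>F\<close>, so for \<open>x\<close> in
      \<open>F\<close> the hypothesis would put \<open>f (outer x p)\<close> into
      \<open>N\<close>.\<close>
    then have "x \<notin> F"
      using less.prems annih_mono[OF FF'] by auto
    define N' where "N' = {a + b | a b. a \<in> N \<and> b \<in> {f (outer x p) | p. p \<in> annih F'}}"
    have sN': "vec.subspace N'"
      unfolding N'_def by (intro vec.subspace_sums less.prems subspace_outer_annih)
    have "0 \<in> {f (outer x p) | p. p \<in> annih F'}"
      by (intro vec.subspace_0 subspace_outer_annih less.prems)
    then have "N \<subseteq> N'"
      unfolding N'_def by force
    moreover have "f (outer x p) \<in> N'"
      unfolding N'_def using xp vec.subspace_0[OF less.prems(3)] by force
    ultimately have "N \<subset> N'"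
      using xp by blast
    then have dimN': "vec.dim N < vec.dim N'"
      using sN' less.prems by (intro vec.dim_psubset) (metis vec.span_eq_iff)
    have "vec.dim F' = vec.dim F + 1"
      using y less.prems by (simp add: F'_def vec.dim_insert vec.span_eq_iff[THEN iffD2])
    then have dimF': "vec.dim F' < vec.dim N'"
      using dimN' less.prems by simp
    have "vec.dim N' \<le> CARD('n)"
      by (rule dim_subset_UNIV_cart_gen)
    then have "CARD('n) - vec.dim N' < CARD('n) - vec.dim N"
      using dimN' by simp
    from less.hyps[OF this, of _ F'] show ?thesis
      using exists_invertible_mapped_into_step[OF less.prems(1-4) \<open>x \<notin> F\<close> y] sN' dimF'
      by (simp add: F'_def N'_def)
  qed
qed

section \<open>Surjectivity of linear maps without invertible zeros\<close>

abbreviation nonvanishing_on_GL :: "('a::field ^'n ^'n \<Rightarrow> 'a ^'n) \<Rightarrow> bool" where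
  "nonvanishing_on_GL f \<equiv> \<forall>A. invertible A \<longrightarrow> f A \<noteq> 0"

text \<open>If the range is proper, the kernel \<open>N\<close> of a projection \<open>g\<close>
  onto it is a nonzero complement, and \<open>reach f N {0}\<close> is everything. So
  \<open>f\<close> sends some invertible matrix into \<open>N\<close>, which meets the range only in
  0.\<close>

lemma surj_if_nonvanishing_on_GL:
  fixes f :: "'a::field ^'n ^'n \<Rightarrow> 'a ^'n"
  assumes lin: "Vector_Spaces.linear matrix_scale (*s) f" and nv: "nonvanishing_on_GL f"
  shows "surj f"
proof (rule ccontr)
  assume "\<not> surj f"
  interpret f: Vector_Spaces.linear matrix_scale "(*s)" f by (rule lin)
  have sR: "vec.subspace (range f)"
    by (rule f.subspace_image) simp
  obtain g :: "'a ^'n \<Rightarrow> 'a ^'n" where g: "range g \<subseteq> range f" "Vector_Spaces.linear (*s) (*s) g"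
      "\<And>v. v \<in> range f \<Longrightarrow> g v = v"
    using vec.linear_exists_left_inverse_on[OF vec.linear_id sR] by auto
  interpret g: Vector_Spaces.linear "(*s)" "(*s)" g by (rule g)
  define N where "N = {v. g v = 0}"
  have sN: "vec.subspace N"
    unfolding N_def by (rule g.subspace_kernel)
  have diff: "v - g v \<in> N" for v
  proof -
    have "g (g v) = g v"
      using g(1) by (intro g(3)) auto
    then show ?thesis
      by (simp add: N_def g.diff)
  qed
  have "f A \<in> reach f N {0}" for A
  proof -
    have "matrix.subspace (f -` reach f N {0})"
      by (intro f.subspace_vimage reach_subspace)
    then show ?thesis
      using subspace_outer_UNIV[of "f -` reach f N {0}" A] reach_outer[of _ "{0}" f _ N] by (auto simp: annih_def)
  qed
  then have "range f \<subseteq> reach f N {0}"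
    by blast
  then have "g v \<in> reach f N {0}" for v
    using g(1) by blast
  then have "(v - g v) + g v \<in> reach f N {0}" for v
    by (intro vec.subspace_add[OF reach_subspace] reach_base[OF diff])
  then have full: "reach f N {0} = UNIV"
    by auto
  obtain v where "v \<notin> range f"
    using \<open>\<not> surj f\<close> by auto
  then have "v - g v \<noteq> 0"
    using g(1) by auto
  then have "vec.dim N \<noteq> 0"
    using diff[of v] by auto
  moreover have "vec.dim ({0} :: ('a ^'n) set) = 0"
    by simp
  ultimately have "vec.dim ({0} :: ('a ^'n) set) < vec.dim N"
    by (simp only: neq0_conv)
  from exists_invertible_mapped_into[OF lin _ sN _ this full]
  obtain C where "invertible C" "f C \<in> N"
    using vec.subspace_0[OF sN] by (auto simp: linear_outer[OF lin])
  then show False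
    using nv g(3) by (auto simp: N_def)
qed

section \<open>The kernel when the matrices vanishing on some line are mapped onto
  everything\<close>

lemma linear_functional_eq_dot:
  assumes "\<And>p q. \<phi> (p + q) = \<phi> p + \<phi> q" "\<And>c p. \<phi> (c *s p) = c * \<phi> p"
  obtains z :: "'a::field ^'n" where "\<And>p. \<phi> p = dot p z"
proof
  fix p
  have "Vector_Spaces.linear (*s) (*) \<phi>"
    using assms by unfold_locales auto
  then interpret Vector_Spaces.linear "(*s)" "(*)" \<phi> .
  have "\<phi> p = \<phi> (\<Sum>i\<in>UNIV. p $ i *s axis i 1)"
    by (simp add: basis_expansion)
  also have "\<dots> = dot p (\<chi> i. \<phi> (axis i 1))"
    by (simp add: sum scale scalar_product_def)
  finally show "\<phi> p = dot p (\<chi> i. \<phi> (axis i 1))" .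
qed

text \<open>Comparing \<open>M (a + b)\<close> with \<open>M a + M b\<close> shows, as
  \<open>R\<close> is injective, that the factors at \<open>a\<close> and \<open>b\<close> agree or
  \<open>a\<close> is a multiple of \<open>b\<close>; in the latter case linearity of
  \<open>M\<close> settles it.\<close>

lemma scalar_if_pointwise_scalar:
  fixes M R :: "'a::field ^'n \<Rightarrow> 'a ^'n"
  assumes "Vector_Spaces.linear (*s) (*s) M" "Vector_Spaces.linear (*s) (*s) R" "inj R"
    and "\<And>a. \<exists>c. M a = c *s R a"
  obtains c where "\<And>a. M a = c *s R a"
proof -
  interpret M: Vector_Spaces.linear "(*s)" "(*s)" M by fact
  interpret R: Vector_Spaces.linear "(*s)" "(*s)" R by fact
  obtain k where k: "\<And>a. M a = k a *s R a"
    using assms(4) by metis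
  \<comment> \<open>The vector \<open>a\<close> stays on both sides because the factor
    \<open>k 0\<close> is arbitrary.\<close>
  have eq: "k a *s a = k b *s a" if "b \<noteq> 0" for a b
  proof -
    have "R (k (a + b) *s (a + b)) = R (k a *s a + k b *s b)"
      by (metis M.add R.add R.scale k)
    then have ab: "k (a + b) *s (a + b) = k a *s a + k b *s b"
      using \<open>inj R\<close> by (simp add: inj_eq)
    show ?thesis
    proof (cases "k (a + b) = k a")
      case True
      then have "k a *s b = k b *s b"
        using ab by (simp add: vec.scale_right_distrib)
      then show ?thesis
        using that by simp
    next
      case False
      define e where "e = k (a + b) - k a"
      define h where "h = k b - k (a + b)"
      have "e *s a = h *s b" "e \<noteq> 0"
        using ab False by (simp_all add: e_def h_def vec.scale_right_distrib vec.scale_left_diff_distrib)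
          (simp add: algebra_simps)
      then have "a = (1 / e) *s (h *s b)"
        by (metis nonzero_eq_divide_eq vec.scale_one vec.scale_scale)
      then obtain d where d: "a = d *s b"
        by (metis vec.scale_scale)
      then have "M a = d *s (k b *s R b)"
        by (metis M.scale k)
      then have "R (k a *s a) = R (k b *s a)"
        by (metis R.scale d k mult.commute vec.scale_scale)
      then show ?thesis
        using \<open>inj R\<close> by (simp add: inj_eq)
    qed
  qed
  obtain b :: "'a ^'n" where "b \<noteq> 0"
    by (metis (full_types) zero_neq_one)
  then have "M a = k b *s R a" for a
    using eq[of b a] k by (metis R.scale)
  then show thesis
    by (rule that)
qed

lemma dim_le_1_line:
  assumes "vec.subspace V" "vec.dim V \<le> 1"
  obtains r where "\<And>v. v \<in> V \<Longrightarrow> \<exists>c. v = c *s r"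
proof -
  obtain B where B: "finite B" "vec.span B = V" "card B = vec.dim V"
    using vec.basis_subspace_exists[OF assms(1)] by metis
  then have "B = {} \<or> (\<exists>r. B = {r})"
    using assms(2) by (metis card_0_eq card_1_singletonE le_SucE le_zero_eq One_nat_def)
  then show thesis
    using B by (intro that[of "SOME r. B = {r}"]) (auto simp: vec.span_singleton intro: exI[of _ 0])
qed

text \<open>Were the values to span dimension at least 2, a flag could start: one step leads from
  \<open>F = N = {0}\<close>, where the strict inequality of dimensions fails, to the line of
  \<open>y\<close> and this space of values, where it holds. The outcome would be an invertible zero
  of \<open>f\<close>.\<close>

lemma line_if_full:
  fixes f :: "'a::field ^'n ^'n \<Rightarrow> 'a ^'n"
  assumes lin: "Vector_Spaces.linear matrix_scale (*s) f" and nv: "nonvanishing_on_GL f"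
    and y: "y \<noteq> 0" and full: "reach f {0} (vec.span {y}) = UNIV"
  obtains r where "\<And>p. p \<in> annih (vec.span {y}) \<Longrightarrow> \<exists>c. f (outer x p) = c *s r"
proof (cases "x = 0")
  case True
  then show thesis
    using that[of 0] by (simp add: linear_outer[OF lin])
next
  case False
  define N where "N = {f (outer x p) | p. p \<in> annih (vec.span {y})}"
  have sN: "vec.subspace N"
    unfolding N_def by (rule subspace_outer_annih[OF lin])
  have "vec.dim N \<le> 1"
  proof (rule ccontr)
    assume "\<not> vec.dim N \<le> 1"
    then have dim: "vec.dim (vec.span {y}) < vec.dim N"
      using y by (simp add: vec.dim_insert)
    have "\<exists>C. invertible C \<and> (\<forall>v\<in>{0}. C *v v = v) \<and> f C \<in> {0}"
      using exists_invertible_mapped_into_step[OF lin, of "{0}" "{0}" x y]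
        exists_invertible_mapped_into[OF _ _ sN _ dim] False y full
      by (simp add: linear_outer[OF lin] N_def insert_commute[of y])
    then show False
      using nv by auto
  qed
  then show thesis
    using dim_le_1_line[OF sN] that by (auto simp: N_def) metis
qed

text \<open>
  The maps \<open>p \<mapsto> f (outer x p)\<close> form a linear space of operators of rank at most one, so they share
  their range or their kernel; a common range is excluded by fullness.
\<close>

lemma common_kernel:
  fixes f :: "'a::field ^'n ^'n \<Rightarrow> 'a ^'n"
  assumes lin: "Vector_Spaces.linear matrix_scale (*s) f"
    and full: "reach f {0} (vec.span {y}) = UNIV" and y: "y \<noteq> 0"
    and line: "\<And>x. \<exists>r. \<forall>p\<in>annih (vec.span {y}). \<exists>c. f (outer x p) = c *s r"
    and p1: "p1 \<in> annih (vec.span {y})" "f (outer x1 p1) \<noteq> 0"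
    and p: "p \<in> annih (vec.span {y})" "f (outer x1 p) = 0"
  shows "f (outer x p) = 0"
proof (rule ccontr)
  assume x: "f (outer x p) \<noteq> 0"
  define P where "P = annih (vec.span {y})"
  define r1 where "r1 = f (outer x1 p1)"
  note lo = linear_outer[OF lin]
  have proportional: "\<exists>c. f (outer x q') = c *s f (outer x q)" if *: "q \<in> P" "q' \<in> P" "f (outer x q) \<noteq> 0" for x q q'
  proof -
    obtain r where r: "\<And>p. p \<in> P \<Longrightarrow> \<exists>c. f (outer x p) = c *s r"
      using line[of x] by (auto simp: P_def)
    then obtain c c' where "f (outer x q) = c *s r" "f (outer x q') = c' *s r"
      using *(1,2) by meson
    moreover from this have "c \<noteq> 0"
      using * by auto
    ultimately have "f (outer x q') = (c' / c) *s f (outer x q)"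
      by simp
    then show ?thesis ..
  qed
  have pP: "p1 \<in> P" "p \<in> P"
    using p1 p by (auto simp: P_def)
  \<comment> \<open>Adding \<open>x1\<close> to \<open>z\<close> keeps \<open>f (outer z p)\<close>
    but adds \<open>r1\<close> to \<open>f (outer z p1)\<close>. If \<open>f (outer z p)\<close> is
    nonzero, the old and the new value at \<open>p1\<close> are multiples of it, hence so is
    \<open>r1\<close>.\<close>
  have in_line: "\<exists>c. f (outer z p) = c *s r1" for z
  proof (cases "f (outer z p) = 0")
    case True
    then show ?thesis
      by (auto intro: exI[of _ 0])
  next
    case False
    then obtain c where c: "f (outer z p1) = c *s f (outer z p)"
      using proportional pP by blast
    have "f (outer (z + x1) p) = f (outer z p)"
      by (simp add: lo p)
    then obtain c' where "f (outer (z + x1) p1) = c' *s f (outer z p)"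
      using proportional[of p p1 "z + x1"] pP False by auto
    then have r1: "r1 = (c' - c) *s f (outer z p)"
      using c by (simp add: lo r1_def algebra_simps)
    then have "c' - c \<noteq> 0"
      using p1 by (auto simp: r1_def)
    then have "f (outer z p) = (1 / (c' - c)) *s r1"
      unfolding r1 vec.scale_scale by simp
    then show ?thesis ..
  qed
  have in_line': "\<exists>c. f (outer z q) = c *s r1" if "q \<in> P" "f (outer z p) \<noteq> 0" for z q
    using in_line[of z] proportional[OF pP(2) that] by auto
  \<comment> \<open>If \<open>p\<close> gives 0 at \<open>z\<close>, it gives a nonzero value at
    both \<open>z + x\<close> and \<open>x\<close>, and the value of \<open>q\<close> at
    \<open>z\<close> is the difference of its values there.\<close>
  have "f (outer z q) \<in> vec.span {r1}" if q: "q \<in> P" for z q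
  proof (cases "f (outer z p) = 0")
    case False
    then show ?thesis
      using in_line'[OF q] by (auto simp: vec.span_singleton)
  next
    case True
    then have "f (outer (z + x) p) \<noteq> 0"
      using x by (simp add: lo)
    then obtain c c' where "f (outer (z + x) q) = c *s r1" "f (outer x q) = c' *s r1"
      using in_line'[OF q] x by meson
    then have "f (outer z q) = (c - c') *s r1"
      by (simp add: lo algebra_simps)
    then show ?thesis
      by (simp only: vec.span_scale vec.span_base singletonI)
  qed
  \<comment> \<open>So the whole space is the line of \<open>r1\<close>, which \<open>y\<close>
    spans; since \<open>p1\<close> kills \<open>y\<close>, it is 0.\<close>
  then have "reach f {0} (vec.span {y}) \<subseteq> vec.span {r1}"
    by (intro reach_least) (auto simp: P_def vec.span_zero)
  then have line1: "v \<in> vec.span {r1}" for v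
    using full by auto
  then obtain c where c: "y = c *s r1"
    by (auto simp: vec.span_singleton)
  then have "c \<noteq> 0"
    using y by auto
  have "dot p1 (c *s r1) = 0"
    using p1(1) vec.span_base[of y "{y}"] unfolding annih_def c by blast
  then have "dot p1 r1 = 0"
    using \<open>c \<noteq> 0\<close> by simp
  then have "dot p1 v = 0" for v
    using line1[of v] by (auto simp: vec.span_singleton)
  then have "p1 = 0"
    by (rule dot_eq_0_all)
  then show False
    using p1 by (simp add: lo)
qed

lemma invertible_two_values:
  fixes y z a b :: "'a::field ^'n"
  assumes "y \<noteq> 0" "a \<noteq> 0" "z \<notin> vec.span {y}" "b \<notin> vec.span {a}"
  obtains A where "invertible A" "A *v y = a" "A *v z = b"
proof -
  obtain C where C: "invertible C" "C *v y = a"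
    using invertible_fixing_maps_to[of "{0}" a y] assms by auto
  obtain w where w: "C *v w = b"
    using invertible_mult_vec_surj C by blast
  have "w \<notin> vec.span {y}"
  proof
    assume "w \<in> vec.span {y}"
    then obtain c where "w = c *s y"
      by (auto simp: vec.span_singleton)
    then have "b = c *s a"
      using w C by (simp add: vec.scale)
    then show False
      using assms by (auto simp: vec.span_singleton)
  qed
  then obtain D where "invertible D" "\<And>v. v \<in> vec.span {y} \<Longrightarrow> D *v v = v" "D *v z = w"
    using invertible_fixing_maps_to[OF vec.subspace_span, of w "{y}" z] assms by metis
  then show thesis
    using C w by (intro that[of "C ** D"])
      (auto simp: invertible_mult vec.span_base simp flip: matrix_vector_mul_assoc)
qed

text \<open>The common kernel gives \<open>f (outer x q) = dot q z *s R x\<close> on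
  \<open>P\<close>; one more functional \<open>p0\<close> gives
  \<open>f A = M (A *v y) + R (A *v z)\<close>. An invertible \<open>A\<close> can take any
  independent pair of values at \<open>y\<close> and \<open>z\<close>, which forces M = c R, so that
  \<open>c *s y + z\<close> is the vector sought.\<close>

lemma nonvanishing_full:
  fixes f :: "'a::field ^'n ^'n \<Rightarrow> 'a ^'n"
  assumes lin: "Vector_Spaces.linear matrix_scale (*s) f" and nv: "nonvanishing_on_GL f"
    and y: "y \<noteq> 0" and full: "reach f {0} (vec.span {y}) = UNIV"
  obtains x where "\<And>A. f A = 0 \<longleftrightarrow> A *v x = 0"
proof -
  define P where "P = annih (vec.span {y})"
  note lo = linear_outer[OF lin]
  interpret f: Vector_Spaces.linear matrix_scale "(*s)" f by (rule lin)
  have "\<exists>x p. p \<in> P \<and> f (outer x p) \<noteq> 0"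
  proof (rule ccontr)
    assume "\<not> ?thesis"
    then have "reach f {0} (vec.span {y}) \<subseteq> {0}"
      by (intro reach_least) (auto simp: P_def)
    then show False
      using full y by blast
  qed
  then obtain x1 p where p: "p \<in> P" "f (outer x1 p) \<noteq> 0"
    by blast
  then obtain i where i: "f (outer x1 p) $ i \<noteq> 0"
    by (auto simp: vec_eq_iff)
  \<comment> \<open>\<open>z\<close> represents a coordinate of \<open>f (outer x1 q)\<close> as a
    functional of \<open>q\<close>, normalized to be 1 at \<open>p\<close>.\<close>
  obtain z where z: "\<And>q. f (outer x1 q) $ i / f (outer x1 p) $ i = dot q z"
    using linear_functional_eq_dot[of "\<lambda>q. f (outer x1 q) $ i / f (outer x1 p) $ i"]
    by (auto simp: lo add_divide_distrib)
  then have pz: "dot p z = 1"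
    using i by (metis divide_self)
  have py: "dot q y = 0" if "q \<in> P" for q
    using that vec.span_base[of y "{y}"] by (auto simp: P_def annih_def)
  define R where "R = (\<lambda>x. f (outer x p))"
  have line: "\<exists>r. \<forall>p\<in>annih (vec.span {y}). \<exists>c. f (outer x p) = c *s r" for x
    using line_if_full[OF lin nv y full, of x] by metis
  have onP: "f (outer x q) = dot q z *s R x" if q: "q \<in> P" for x q
  proof -
    obtain r where r: "\<And>p. p \<in> P \<Longrightarrow> \<exists>c. f (outer x1 p) = c *s r"
      using line[of x1] by (auto simp: P_def)
    obtain c c' where c: "f (outer x1 p) = c *s r" "f (outer x1 q) = c' *s r"
      using r p q by meson
    then have "c \<noteq> 0" "r $ i \<noteq> 0"
      using i by auto
    then have "dot q z = c' / c"
      using c z[of q] by simp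
    then have "f (outer x1 (q - dot q z *s p)) = 0"
      using c \<open>c \<noteq> 0\<close> by (simp add: lo vec.scale_scale)
    moreover have "q - dot q z *s p \<in> P"
      using p q by (simp add: P_def annih_diff)
    ultimately have "f (outer x (q - dot q z *s p)) = 0"
      using common_kernel[OF lin full y line] p unfolding P_def by blast
    then show ?thesis
      by (simp add: lo R_def)
  qed
  obtain p0 where p0: "dot p0 y = 1"
    using separating_functional[of "{0}" y] y by (auto)
  \<comment> \<open>\<open>M\<close> is the value at \<open>p0\<close> minus the share that
    \<open>R\<close> already contributes through \<open>z\<close>.\<close>
  define M where "M = (\<lambda>x. f (outer x p0) - dot p0 z *s R x)"
  have linR: "Vector_Spaces.linear (*s) (*s) R"
    by unfold_locales (simp_all add: R_def lo vec.scale_right_distrib)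
  have linM: "Vector_Spaces.linear (*s) (*s) M"
    by unfold_locales
      (simp_all add: M_def R_def lo vec.scale_right_distrib vec.scale_right_diff_distrib vec.scale_scale mult.commute)
  interpret M: Vector_Spaces.linear "(*s)" "(*s)" M by (rule linM)
  interpret R: Vector_Spaces.linear "(*s)" "(*s)" R by (rule linR)
  have f_outer: "f (outer x q) = M (outer x q *v y) + R (outer x q *v z)" for x q
  proof -
    have "q - dot q y *s p0 \<in> P"
      using p0 by (auto simp: P_def annih_def vec.span_singleton)
    from onP[OF this, of x] show ?thesis
      by (simp add: lo M_def M.scale R.scale algebra_simps vec.scale_left_diff_distrib
          vec.scale_right_diff_distrib vec.scale_scale)
  qed
  have f: "f A = M (A *v y) + R (A *v z)" for A
  proof -
    have "matrix_scale c A *v v = c *s (A *v v)" for c A and v :: "'a ^'n"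
      by (simp add: matrix_scale_def map_matrix_def matrix_vector_mult_def vec_eq_iff sum_distrib_left mult_ac)
    then have "matrix.subspace {A. f A = M (A *v y) + R (A *v z)}"
      by (auto simp: matrix.subspace_def f.add f.scale M.add M.scale R.add R.scale
          matrix_vector_mult_add_rdistrib vec.scale_right_distrib)
    from subspace_outer_UNIV[OF this] show ?thesis
      using f_outer by blast
  qed
  have "reach f {0} (vec.span {y}) \<subseteq> range R"
  proof (rule reach_least)
    show "vec.subspace (range R)"
      by (rule R.subspace_image) simp
    show "{0} \<subseteq> range R"
      using R.zero by (metis empty_subsetI insert_subset rangeI)
    show "f (outer x q) \<in> range R" if "q \<in> annih (vec.span {y})" for x q
      using onP[of q x] that by (auto simp: P_def simp flip: R.scale)
  qed
  then have "surj R"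
    using full by auto
  then have "inj R"
    using vec.linear_surj_imp_inj linR by blast
  \<comment> \<open>Otherwise the \<open>b\<close> with \<open>R b = - M a\<close> is independent of
    \<open>a\<close>, and an invertible \<open>A\<close> taking \<open>y\<close> to \<open>a\<close>
    and \<open>z\<close> to \<open>b\<close> is a zero of \<open>f\<close>.\<close>
  have "\<exists>c. M a = c *s R a" for a
  proof (rule ccontr)
    assume *: "\<not> ?thesis"
    then have "a \<noteq> 0"
      by (auto simp: M.zero R.zero)
    obtain b where b: "R b = - M a"
      using \<open>surj R\<close> by (metis surjD)
    have "b \<notin> vec.span {a}"
    proof
      assume "b \<in> vec.span {a}"
      then obtain c where "b = c *s a"
        by (auto simp: vec.span_singleton)
      then have "M a = (- c) *s R a"
        using b by (simp add: R.scale)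
      then show False
        using * by blast
    qed
    moreover have "z \<notin> vec.span {y}"
    proof
      assume "z \<in> vec.span {y}"
      then obtain c where "z = c *s y"
        by (auto simp: vec.span_singleton)
      then show False
        using pz py[OF p(1)] by simp
    qed
    ultimately obtain A where "invertible A" "A *v y = a" "A *v z = b"
      using invertible_two_values[OF y \<open>a \<noteq> 0\<close>] by blast
    then show False
      using nv f[of A] b by simp
  qed
  then obtain c where c: "\<And>a. M a = c *s R a"
    using scalar_if_pointwise_scalar[OF linM linR \<open>inj R\<close>] by blast
  have "f A = R (A *v (c *s y + z))" for A
    by (simp add: f c R.add R.scale vec.add vec.scale)
  then have "f A = 0 \<longleftrightarrow> A *v (c *s y + z) = 0" for A
    using R.inj_iff_eq_0 \<open>inj R\<close> R.zero by metis
  then show thesis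
    by (rule that)
qed

section \<open>The kernel when no line gives everything\<close>

lemmas [simp del] = transpose_matrix_vector

lemma transpose_outer_mult_vec: "transpose (outer x p) *v w = dot x w *s p"
  by (simp add: outer_simps)

lemma linear_mult_vec: "Vector_Spaces.linear matrix_scale (*s) (\<lambda>A. A *v x)"
  and linear_transpose_mult_vec: "Vector_Spaces.linear matrix_scale (*s) (\<lambda>A. transpose A *v x)"
  by unfold_locales
    (simp_all add: transpose_def matrix_scale_def map_matrix_def matrix_vector_mult_def vec_eq_iff
      sum.distrib sum_distrib_left algebra_simps)

lemma eq_transpose_mult_vecI:
  fixes f :: "'a::field ^'n ^'n \<Rightarrow> 'a ^'n"
  assumes lin: "Vector_Spaces.linear matrix_scale (*s) f"
    and outer: "\<And>x p. dot u (f (outer x p)) = p $ i * dot x w"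
  shows "dot u (f A) = (transpose A *v w) $ i"
proof -
  interpret f: Vector_Spaces.linear matrix_scale "(*s)" f by (rule lin)
  interpret t: Vector_Spaces.linear matrix_scale "(*s)" "\<lambda>A. transpose A *v w"
    by (rule linear_transpose_mult_vec)
  have "matrix.subspace {A. dot u (f A) = (transpose A *v w) $ i}"
    unfolding matrix.subspace_def
    by (simp only: mem_Collect_eq f.zero t.zero f.add t.add f.scale t.scale dot_simps zero_index
        vector_add_component vector_smult_component) simp
  from subspace_outer_UNIV[OF this] show ?thesis
    using outer by (auto simp: transpose_outer_mult_vec mult.commute)
qed

text \<open>A functional \<open>u i\<close> that kills the image of the matrices vanishing at
  \<open>axis i 1\<close> sees only column \<open>i\<close> of \<open>A\<close>, through a vector
  \<open>w i\<close>. The lines of \<open>axis i 1 + axis k 1\<close> show that all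
  \<open>w i\<close> are proportional, and the \<open>u i\<close> are the rows of an injective
  \<open>Q\<close>; so \<open>f A\<close> vanishes exactly when \<open>transpose A\<close> kills one
  of the \<open>w i\<close>.\<close>

lemma nonvanishing_never_full:
  fixes f :: "'a::field ^'n ^'n \<Rightarrow> 'a ^'n"
  assumes lin: "Vector_Spaces.linear matrix_scale (*s) f" and nv: "nonvanishing_on_GL f"
    and not_full: "\<And>y. y \<noteq> 0 \<Longrightarrow> reach f {0} (vec.span {y}) \<noteq> UNIV"
  obtains w where "\<And>A. f A = 0 \<longleftrightarrow> transpose A *v w = 0"
proof -
  interpret f: Vector_Spaces.linear matrix_scale "(*s)" f by (rule lin)
  note lo = linear_outer[OF lin]
  have surj: "surj f"
    using surj_if_nonvanishing_on_GL[OF lin nv] .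
  have "\<exists>u w. u \<noteq> 0 \<and> (\<forall>A. dot u (f A) = (transpose A *v w) $ i)" for i
  proof -
    have "reach f {0} (vec.span {axis i 1}) \<noteq> UNIV"
      by (rule not_full) simp
    then obtain v where "v \<notin> reach f {0} (vec.span {axis i 1})"
      by blast
    then obtain u where u: "u \<in> annih (reach f {0} (vec.span {axis i 1}))" "dot u v = 1"
      using separating_functional[OF reach_subspace] by blast
    obtain w where w: "\<And>x. dot u (f (outer x (axis i 1))) = dot x w"
      using linear_functional_eq_dot[of "\<lambda>x. dot u (f (outer x (axis i 1)))"] by (auto simp: lo)
    have "dot u (f (outer x p)) = p $ i * dot x w" for x p
    proof -
      have "p - p $ i *s axis i 1 \<in> annih (vec.span {axis i 1})"
        by (auto simp: annih_def vec.span_singleton)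
      then have "dot u (f (outer x (p - p $ i *s axis i 1))) = 0"
        using u(1) reach_outer unfolding annih_def[of "reach _ _ _"] by blast
      then show ?thesis
        by (simp add: lo w)
    qed
    then have "dot u (f A) = (transpose A *v w) $ i" for A
      by (rule eq_transpose_mult_vecI[OF lin])
    moreover have "u \<noteq> 0"
      using u by auto
    ultimately show ?thesis
      by blast
  qed
  then obtain u w where u: "\<And>i. u i \<noteq> 0" and uw: "\<And>i A. dot (u i) (f A) = (transpose A *v w i) $ i"
    by metis
  have w: "w i \<noteq> 0" for i
  proof
    assume "w i = 0"
    then have "dot (u i) (f A) = 0" for A
      using uw[of i A] by simp
    then have "u i = 0"
      using surj by (intro dot_eq_0_all) (metis surjD)
    then show False
      using u by blast
  qed
  then have ex: "\<exists>x. dot x (w i) = 1" for i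
    using separating_functional[of "{0}" "w i"] by (metis singletonD vec.subspace_single_0)
  define Q where "Q = (\<chi> i. u i)"
  have Q: "(Q *v v) $ i = dot (u i) v" for v i
    by (simp add: Q_def matrix_vector_mult_def scalar_product_def)
  have Qf: "(Q *v f A) $ i = (transpose A *v w i) $ i" for A i
    by (simp add: Q uw)
  have Q_outer: "Q *v f (outer x p) = (\<chi> i. p $ i * dot x (w i))" for x p
    by (simp add: vec_eq_iff Qf transpose_outer_mult_vec mult.commute)
  have full_if: "V = UNIV" if "vec.subspace V" "\<And>k. axis k 1 \<in> V" for V :: "('a ^'n) set"
  proof -
    have "(\<Sum>i\<in>UNIV. v $ i *s axis i 1) \<in> V" for v
      by (intro vec.subspace_sum vec.subspace_scale that)
    then show ?thesis
      by (auto simp: basis_expansion)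
  qed
  have Q_axis: "Q *v f (outer x (axis k 1)) = dot x (w k) *s axis k 1" for x k
    by (auto simp: Q_outer vec_eq_iff axis_def)
  have "range ((*v) Q) = UNIV"
  proof (rule full_if)
    show "vec.subspace (range ((*v) Q))"
      by (rule vec.subspace_image) simp
    show "axis k 1 \<in> range ((*v) Q)" for k
      using ex[of k] Q_axis[of _ k] by (metis rangeI vec.scale_one)
  qed
  then have "inj ((*v) Q)"
    using vec.linear_surj_imp_inj matrix_vector_mul_linear_gen by blast
  have in_line: "w k \<in> vec.span {w i}" if "i \<noteq> k" for i k
  proof (rule ccontr)
    assume "w k \<notin> vec.span {w i}"
    then obtain x where x: "x \<in> annih (vec.span {w i})" "dot x (w k) = 1"
      using separating_functional[OF vec.subspace_span] by metis
    then have xi: "dot x (w i) = 0"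
      by (auto simp: annih_def intro: vec.span_base)
    \<comment> \<open>The line of this \<open>y\<close> would be full:
      \<open>axis k 1 - axis i 1\<close> kills \<open>y\<close> and, paired with \<open>x\<close>,
      yields \<open>axis k 1\<close>. Given that, \<open>axis i 1\<close> follows, and for any other
      \<open>l\<close> the functional \<open>axis l 1\<close> kills \<open>y\<close> itself.\<close>
    define y :: "'a ^'n" where "y = axis i 1 + axis k 1"
    have "y $ i = 1"
      using that by (simp add: y_def axis_def)
    then have "y \<noteq> 0"
      by auto
    define V where "V = reach f {0} (vec.span {y})"
    have sV: "vec.subspace ((*v) Q ` V)"
      unfolding V_def by (intro vec.subspace_image reach_subspace)
    have in_V: "Q *v f (outer x p) \<in> (*v) Q ` V" if "dot p y = 0" for x p
    proof -
      have "p \<in> annih (vec.span {y})"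
        using that by (auto simp: annih_def vec.span_singleton)
      then show ?thesis
        unfolding V_def by (intro imageI reach_outer)
    qed
    have dot_y: "dot p y = p $ i + p $ k" for p
      by (simp add: y_def)
    have k: "axis k 1 \<in> (*v) Q ` V"
    proof -
      have "Q *v f (outer x (axis k 1 - axis i 1)) = axis k 1"
        using x xi that by (auto simp: Q_outer vec_eq_iff axis_def)
      moreover have "Q *v f (outer x (axis k 1 - axis i 1)) \<in> (*v) Q ` V"
        using that by (intro in_V) (auto simp: dot_y axis_def)
      ultimately show ?thesis
        by simp
    qed
    have "axis l 1 \<in> (*v) Q ` V" for l
    proof -
      obtain x' where x': "dot x' (w l) = 1"
        using ex by blast
      consider "l = k" | "l = i" | "l \<noteq> k" "l \<noteq> i"
        by blast
      then show ?thesis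
      proof cases
        case 2
        have "Q *v f (outer x' (axis i 1 - axis k 1)) + dot x' (w k) *s axis k 1 \<in> (*v) Q ` V"
          using k that by (intro vec.subspace_add vec.subspace_scale sV in_V) (auto simp: dot_y axis_def)
        moreover have "Q *v f (outer x' (axis i 1 - axis k 1)) + dot x' (w k) *s axis k 1 = axis i 1"
          using x' 2 that by (auto simp: Q_outer vec_eq_iff axis_def)
        ultimately show ?thesis
          by (simp add: 2)
      next
        case 3
        have "Q *v f (outer x' (axis l 1)) \<in> (*v) Q ` V"
          using 3 by (intro in_V) (auto simp: dot_y axis_def)
        then show ?thesis
          by (simp add: Q_axis x')
      qed (use k in simp)
    qed
    then have "(*v) Q ` V = UNIV"
      by (intro full_if sV)
    then have "V = UNIV"
      using \<open>inj ((*v) Q)\<close> by (metis inj_image_eq_iff \<open>range ((*v) Q) = UNIV\<close>)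
    then show False
      using not_full[OF \<open>y \<noteq> 0\<close>] by (simp add: V_def)
  qed
  obtain i0 :: 'n where True
    by blast
  have "\<exists>c. c \<noteq> 0 \<and> w i = c *s w i0" for i
  proof -
    have "w i \<in> vec.span {w i0}"
      using in_line[of i0 i] by (cases "i = i0") (auto intro: vec.span_base)
    then obtain c where "w i = c *s w i0"
      by (auto simp: vec.span_singleton)
    then show ?thesis
      using w[of i] by (intro exI[of _ c]) auto
  qed
  then obtain c where c: "\<And>i. c i \<noteq> 0" "\<And>i. w i = c i *s w i0"
    by metis
  have "f A = 0 \<longleftrightarrow> transpose A *v w i0 = 0" for A
  proof -
    have Qc: "(Q *v f A) $ i = c i * (transpose A *v w i0) $ i" for i
      unfolding Qf by (subst c(2)) (simp add: vec.scale)
    have "f A = 0 \<longleftrightarrow> Q *v f A = 0"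
      using inj_eq[OF \<open>inj ((*v) Q)\<close>, of "f A" 0] by simp
    also have "\<dots> \<longleftrightarrow> (\<forall>i. c i * (transpose A *v w i0) $ i = 0)"
      by (simp add: vec_eq_iff Qc)
    also have "\<dots> \<longleftrightarrow> transpose A *v w i0 = 0"
      using c(1) by (simp add: vec_eq_iff)
    finally show ?thesis .
  qed
  then show thesis
    by (rule that)
qed

lemma kernel_if_nonvanishing_on_GL:
  fixes f :: "'a::field ^'n ^'n \<Rightarrow> 'a ^'n"
  assumes "Vector_Spaces.linear matrix_scale (*s) f" "nonvanishing_on_GL f"
  shows "(\<exists>x. \<forall>A. f A = 0 \<longleftrightarrow> A *v x = 0) \<or> (\<exists>w. \<forall>A. f A = 0 \<longleftrightarrow> transpose A *v w = 0)"
  using nonvanishing_full[OF assms] nonvanishing_never_full[OF assms] by metis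

section \<open>Green's relations in terms of kernels\<close>

text \<open>\<open>X\<close> is \<open>A\<close> after a linear right inverse \<open>g\<close> of
  \<open>B\<close> on its range: \<open>g (B *v v) - v\<close> lies in the kernel of
  \<open>B\<close>, hence in that of \<open>A\<close>.\<close>

lemma left_factor_if_kernel_subset:
  fixes A B :: "'a::field ^'n ^'n"
  assumes "\<And>v. B *v v = 0 \<Longrightarrow> A *v v = 0"
  obtains X where "A = X ** B"
proof -
  obtain g where g: "Vector_Spaces.linear (*s) (*s) g" "\<And>v. B *v g (B *v v) = B *v v"
    using vec.linear_exists_right_inverse_on[OF matrix_vector_mul_linear_gen vec.subspace_UNIV, of B]
    by blast
  have "A *v v = (A ** matrix g ** B) *v v" for v
  proof -
    have "B *v (g (B *v v) - v) = 0"
      using g by (simp add: vec.diff)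
    then have "A *v (g (B *v v) - v) = 0"
      by (rule assms)
    then show ?thesis
      by (simp add: vec.diff matrix_works[OF g(1)] flip: matrix_vector_mul_assoc)
  qed
  then show thesis
    using that matrix_eq by blast
qed

lemma green_L_iff_kernel: "green_L A B \<longleftrightarrow> (\<forall>v. A *v v = 0 \<longleftrightarrow> B *v v = 0)"
proof
  assume "green_L A B"
  then obtain X Y where "A = X ** B" "B = Y ** A"
    by (auto simp: green_L_def)
  then show "\<forall>v. A *v v = 0 \<longleftrightarrow> B *v v = 0"
    by (metis matrix_vector_mul_assoc matrix_vector_mult_0_right)
next
  assume "\<forall>v. A *v v = 0 \<longleftrightarrow> B *v v = 0"
  then show "green_L A B"
    unfolding green_L_def by (metis left_factor_if_kernel_subset)
qed

lemma green_R_iff_green_L_transpose: "green_R A B \<longleftrightarrow> green_L (transpose A) (transpose B)"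
  unfolding green_R_def green_L_def by (metis matrix_transpose_mul transpose_transpose)

lemma green_H_iff_kernel:
  "green_H A B \<longleftrightarrow> (\<forall>v. (A *v v = 0 \<longleftrightarrow> B *v v = 0) \<and> (transpose A *v v = 0 \<longleftrightarrow> transpose B *v v = 0))"
  by (auto simp: green_H_def green_R_iff_green_L_transpose green_L_iff_kernel)

lemma invertible_transpose: "invertible A \<Longrightarrow> invertible (transpose A)"
  for A :: "'a::field ^'n ^'n"
  by (metis invertible_def matrix_transpose_mul transpose_mat)

section \<open>Preserving invertibility and preserving Green's relation H\<close>

lemma preserves_H_if_preserves_invertibility:
  fixes T :: "'a::field ^'n ^'n \<Rightarrow> 'a ^'n ^'n"
  assumes lin: "Vector_Spaces.linear matrix_scale matrix_scale T" and inv: "preserves_invertibility T"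
  shows "preserves_H T"
proof -
  \<comment> \<open>Whether \<open>f A\<close> vanishes depends only on the kernel or only on the
    left kernel of \<open>A\<close>, and H-related matrices share both.\<close>
  have ker_eq: "f A = 0 \<longleftrightarrow> f B = 0"
    if "green_H A B" "Vector_Spaces.linear matrix_scale (*s) f" "nonvanishing_on_GL f"
    for f :: "'a ^'n ^'n \<Rightarrow> 'a ^'n" and A B
    using kernel_if_nonvanishing_on_GL[OF that(2,3)] that(1) by (auto simp: green_H_iff_kernel)
  show ?thesis
    unfolding preserves_H_def green_H_iff_kernel[of "T _"]
  proof (intro allI impI)
    fix A B :: "'a ^'n ^'n" and v :: "'a ^'n"
    assume AB: "green_H A B"
    have "T A *v v = 0 \<longleftrightarrow> T B *v v = 0" "transpose (T A) *v v = 0 \<longleftrightarrow> transpose (T B) *v v = 0"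
      if "v \<noteq> 0"
    proof -
      have TC: "invertible (T C)" if "invertible C" for C
        using inv that by (simp add: preserves_invertibility_def)
      have "nonvanishing_on_GL (\<lambda>A. T A *v v)" "nonvanishing_on_GL (\<lambda>A. transpose (T A) *v v)"
        using TC invertible_transpose[OF TC] \<open>v \<noteq> 0\<close> unfolding invertible_iff_ker[of "T _"]
          invertible_iff_ker[of "transpose _"] by blast+
      then show "T A *v v = 0 \<longleftrightarrow> T B *v v = 0" "transpose (T A) *v v = 0 \<longleftrightarrow> transpose (T B) *v v = 0"
        using ker_eq[OF AB Vector_Spaces.linear_compose[OF lin linear_mult_vec, unfolded o_def]]
          ker_eq[OF AB Vector_Spaces.linear_compose[OF lin linear_transpose_mult_vec, unfolded o_def]]
        by (simp_all only:)
    qed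
    then show "(T A *v v = 0 \<longleftrightarrow> T B *v v = 0) \<and> (transpose (T A) *v v = 0 \<longleftrightarrow> transpose (T B) *v v = 0)"
      by (cases "v = 0") auto
  qed
qed

text \<open>If \<open>p\<close> kills some \<open>y \<noteq> 0\<close>, then for an invertible
  \<open>C\<close> with \<open>C *v y = x\<close> both \<open>C\<close> and
  \<open>C - outer x p\<close> are invertible. Otherwise n = 1, and \<open>outer x p\<close> is
  itself invertible for \<open>x \<noteq> 0\<close>.\<close>

lemma subspace_invertible_UNIV:
  fixes V :: "('a::field ^'n ^'n) set"
  assumes V: "matrix.subspace V" and inv: "\<And>A. invertible A \<Longrightarrow> A \<in> V"
  shows "A \<in> V"
proof (rule subspace_outer_UNIV[OF V])
  fix x p :: "'a ^'n"
  show "outer x p \<in> V"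
  proof (cases "x = 0")
    case True
    then have "outer x p = 0"
      by (simp add: outer_def vec_eq_iff)
    then show ?thesis
      using V matrix.subspace_0 by simp
  next
    case x: False
    show ?thesis
    proof (cases "\<exists>y. y \<noteq> 0 \<and> dot p y = 0")
      case True
      then obtain y where y: "y \<noteq> 0" "dot p y = 0"
        by blast
      then obtain C where C: "invertible C" "C *v y = x"
        using invertible_fixing_maps_to[of "{0}" x y] x by auto
      then have "C - (C - outer x p) \<in> V"
        using matrix.subspace_diff[OF V inv inv] invertible_minus_outer[OF C(1) y(2)] by blast
      then show ?thesis
        by simp
    next
      case False
      then have "invertible (outer x p)"
        using x by (auto simp: invertible_iff_ker)
      then show ?thesis
        by (rule inv)
    qed
  qed
qed

lemma preserves_invertibility_if_preserves_H:
  fixes T :: "'a::field ^'n ^'n \<Rightarrow> 'a ^'n ^'n"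
  assumes lin: "Vector_Spaces.linear matrix_scale matrix_scale T" and H: "preserves_H T"
    and "T \<noteq> (\<lambda>A. 0)"
  shows "preserves_invertibility T"
  unfolding preserves_invertibility_def
proof (intro allI impI)
  interpret T: Vector_Spaces.linear matrix_scale matrix_scale T by (rule lin)
  fix A :: "'a ^'n ^'n"
  assume A: "invertible A"
  \<comment> \<open>Invertible matrices have zero kernel and zero left kernel, so they are all
    H-related.\<close>
  have TA: "green_H (T A) (T B)" if "invertible B" for B
  proof -
    have "C *v v = 0 \<longleftrightarrow> v = 0" if "invertible C" for C :: "'a ^'n ^'n" and v
      using that by (auto simp: invertible_iff_ker)
    from this[OF A] this[OF \<open>invertible B\<close>] this[OF invertible_transpose[OF A]]
      this[OF invertible_transpose[OF \<open>invertible B\<close>]]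
    have "green_H A B"
      by (simp add: green_H_iff_kernel)
    then show ?thesis
      using H by (simp add: preserves_H_def)
  qed
  have "T A \<noteq> 0"
  proof
    assume "T A = 0"
    then have "T B = 0" if "invertible B" for B
      using TA[OF that] by (auto simp: green_H_iff_kernel matrix_eq)
    then have "T B = 0" for B
      using subspace_invertible_UNIV[of "{A. T A = 0}"] T.subspace_kernel by blast
    then show False
      using assms by auto
  qed
  then obtain v where v: "T A *v v \<noteq> 0"
    by (auto simp: matrix_eq)
  define f where "f = (\<lambda>B. T B *v v)"
  have linf: "Vector_Spaces.linear matrix_scale (*s) f"
    using Vector_Spaces.linear_compose[OF lin linear_mult_vec] by (simp add: f_def o_def)
  interpret f: Vector_Spaces.linear matrix_scale "(*s)" f by (rule linf)
  have "nonvanishing_on_GL f"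
    using TA v by (auto simp: f_def green_H_iff_kernel)
  then have "surj f"
    by (rule surj_if_nonvanishing_on_GL[OF linf])
  \<comment> \<open>For invertible \<open>B\<close>, the relation R makes \<open>T B\<close> a right
    multiple of \<open>T A\<close>, so its range lies in that of \<open>T A\<close>; the invertible
    matrices span.\<close>
  moreover have "f B \<in> range ((*v) (T A))" for B
  proof -
    have "matrix.subspace (f -` range ((*v) (T A)))"
      by (intro f.subspace_vimage vec.subspace_image) simp
    moreover have "B \<in> f -` range ((*v) (T A))" if B: "invertible B" for B
    proof -
      obtain X where "T B = T A ** X"
        using TA[OF B] by (auto simp: green_H_def green_R_def)
      then show ?thesis
        by (auto simp: f_def simp flip: matrix_vector_mul_assoc)
    qed
    ultimately show ?thesis
      using subspace_invertible_UNIV by blast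
  qed
  ultimately have "surj ((*v) (T A))"
    by (metis surj_def rangeE)
  then show "invertible (T A)"
    by (simp add: invertible_right_inverse matrix_right_invertible_surjective)
qed

theorem theorem4p3:
  fixes T :: "'a::field ^'n ^'n \<Rightarrow> 'a ^'n ^'n"
  assumes "Vector_Spaces.linear matrix_scale matrix_scale T"
  shows "preserves_H T \<longleftrightarrow> T = (\<lambda>A. 0) \<or> preserves_invertibility T"
proof -
  have "preserves_H (\<lambda>A. 0 :: 'a ^'n ^'n)"
    by (simp add: preserves_H_def green_H_iff_kernel)
  then show ?thesis
    using preserves_H_if_preserves_invertibility[OF assms] preserves_invertibility_if_preserves_H[OF assms]
    by auto
qed

end
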